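(* Let $H$ be a subgroup of finite index in Thompson's group $F$. Then $H$ contains $F'$, the commutator subgroup of $F$, and hence $H$ is normal in $F$. Moreover, $H'=F'$, where $H'$ is the commutator subgroup of $H$.
   Context: Thompson's group $F$ is the group, under composition, of all order-preserving homeomorphisms $f\colon\mathbb{R}\to\mathbb{R}$ that are piecewise linear with a discrete set of breakpoints (finitely many in every bounded interval), all breakpoints in $\mathbb{Z}[\frac12]$, all slopes integral powers of $2$, $f(\mathbb{Z}[\frac12])\subset\mathbb{Z}[\frac12]$, and for which there exist integers $l,r$ and a real $M>0$ with $f(t)=t+r$ for all $t>M$ and $f(t)=t+l$ for all $t<-M$. *)

theory Defs
  imports "HOL-Analysis.Analysis" "HOL-Algebra.Generated_Groups"
begin

definition dyadic :: "real set" where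
  "dyadic = {x. \<exists>(a::int) (n::nat). x = of_int a / 2 ^ n}"

definition affine_with_slope :: "(real \<Rightarrow> real) \<Rightarrow> real \<Rightarrow> real set \<Rightarrow> bool" where
  "affine_with_slope f m S \<longleftrightarrow> (\<exists>c. \<forall>t\<in>S. f t = m * t + c)"

definition breakpoints :: "(real \<Rightarrow> real) \<Rightarrow> real set" where
  "breakpoints f = {x. \<not> (\<exists>e>0. \<exists>m. affine_with_slope f m {x - e<..<x + e})}"

definition slopes :: "(real \<Rightarrow> real) \<Rightarrow> real set" where
  "slopes f = {m. \<exists>a b. a < b \<and> affine_with_slope f m {a<..<b}}"

text \<open>On an interval without breakpoints a function is locally affine, hence affine by
  connectedness; so it suffices to ask that the breakpoints be finite in number on every
  bounded interval.\<close>

definition piecewise_linear :: "(real \<Rightarrow> real) \<Rightarrow> bool" where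
  "piecewise_linear f \<longleftrightarrow> continuous_on UNIV f \<and> (\<forall>a b. finite (breakpoints f \<inter> {a..b}))"

definition thompson_homeos :: "(real \<Rightarrow> real) set" where
  "thompson_homeos = {f.
     (\<exists>g. homeomorphism UNIV UNIV f g) \<and> mono f \<and>
     piecewise_linear f \<and> breakpoints f \<subseteq> dyadic \<and>
     slopes f \<subseteq> {2 powi k | k :: int. True} \<and>
     f ` dyadic \<subseteq> dyadic \<and>
     (\<exists>(l::int) (r::int) (M::real). M > 0 \<and>
        (\<forall>t. t > M \<longrightarrow> f t = t + of_int r) \<and> (\<forall>t. t < - M \<longrightarrow> f t = t + of_int l))}"

definition thompson_F :: "(real \<Rightarrow> real) monoid" where
  "thompson_F = \<lparr>carrier = thompson_homeos, mult = (\<circ>), one = id\<rparr>"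

end

theory Submission
  imports Defs
begin

text \<open>Let \<open>C\<close> be the group of compactly supported elements of \<open>F\<close> and \<open>\<tau>\<close> the translation by 1.
  If \<open>H\<close> has finite index then, for \<open>h, f \<in> C\<close> and suitable large \<open>N\<close>, \<open>H\<close> contains \<open>\<tau>\<^sup>N\<close> and its
  conjugates by \<open>h\<close> and \<open>f\<close>, hence also \<open>x = [h, \<tau>\<^sup>N]\<close> and \<open>y = [f, \<tau>\<^sup>-\<^sup>N]\<close>.
  These are \<open>h\<close> and \<open>f\<close> times elements supported far to the right and far to the left, so
  \<open>[x, y] = [h, f]\<close> and therefore \<open>C' \<subseteq> H'\<close>.
  On the other hand \<open>F' \<subseteq> C'\<close>: every element of \<open>F\<close> agrees on any given bounded interval with
  an element of \<open>C\<close>, so \<open>C/C'\<close> is central in \<open>F/C'\<close>, and \<open>F\<close> is generated by \<open>C\<close> together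
  with two commuting elements that realise the translations near \<open>+\<infinity>\<close> and near \<open>-\<infinity>\<close>.
  Hence \<open>F' \<subseteq> C' \<subseteq> H' \<subseteq> F'\<close>.\<close>

section \<open>Thompson homeomorphisms via germs\<close>

lemma dyadic_of_int [simp]: "of_int a \<in> dyadic"
  unfolding dyadic_def by (auto intro!: exI[of _ a] exI[of _ "0::nat"])

lemma dyadic_add:
  assumes "x \<in> dyadic" "y \<in> dyadic"
  shows "x + y \<in> dyadic"
proof -
  obtain a n b m where xy: "x = of_int a / 2 ^ n" "y = of_int b / 2 ^ m"
    using assms by (auto simp: dyadic_def)
  have "x + y = of_int (a * 2 ^ m + b * 2 ^ n) / 2 ^ (n + m)"
    unfolding xy by (simp add: field_simps power_add)
  then show ?thesis
    unfolding dyadic_def by blast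
qed

lemma dyadic_uminus:
  assumes "x \<in> dyadic"
  shows "- x \<in> dyadic"
proof -
  obtain a n where "x = of_int a / 2 ^ n"
    using assms by (auto simp: dyadic_def)
  then have "- x = of_int (- a) / 2 ^ n"
    by simp
  then show ?thesis
    unfolding dyadic_def by blast
qed

lemma dyadic_diff: "x \<in> dyadic \<Longrightarrow> y \<in> dyadic \<Longrightarrow> x - y \<in> dyadic"
  using dyadic_add[of x "- y"] dyadic_uminus[of y] by simp

lemma dyadic_mult_pow2:
  assumes "x \<in> dyadic"
  shows "2 powi k * x \<in> dyadic"
proof -
  obtain a n where x: "x = of_int a / 2 ^ n"
    using assms by (auto simp: dyadic_def)
  show ?thesis
  proof (cases "k \<ge> 0")
    case True
    then have "2 powi k * x = of_int (2 ^ nat k * a) / 2 ^ n"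
      by (simp add: x power_int_def)
    then show ?thesis
      unfolding dyadic_def by blast
  next
    case False
    then have "2 powi k * x = of_int a / 2 ^ (n + nat (- k))"
      by (simp add: x power_int_def field_simps power_add)
    then show ?thesis
      unfolding dyadic_def by blast
  qed
qed

lemma dyadic_dense:
  fixes a b :: real
  assumes "a < b"
  obtains d where "d \<in> dyadic" "a < d" "d < b"
proof -
  obtain n where n: "inverse (2 ^ n) < b - a"
    using real_arch_pow_inv[of "b - a" "1 / 2"] assms by (auto simp: power_one_over inverse_eq_divide)
  \<comment> \<open>The least multiple of 2^-n strictly above \<open>a\<close>; it exceeds
    \<open>a\<close> by at most 2^-n, which is less than \<open>b - a\<close>.\<close>
  define d where "d = of_int (\<lfloor>2 ^ n * a\<rfloor> + 1) / (2 ^ n :: real)"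
  have "2 ^ n * a < of_int (\<lfloor>2 ^ n * a\<rfloor> + 1)" "of_int (\<lfloor>2 ^ n * a\<rfloor> + 1) \<le> 2 ^ n * a + 1"
    by linarith+
  then have "a < d" "d \<le> a + inverse (2 ^ n)"
    by (auto simp: d_def field_simps)
  moreover have "d \<in> dyadic"
    unfolding dyadic_def d_def by blast
  ultimately show ?thesis
    using that n by force
qed

section \<open>Affine germs whose slope is a power of 2\<close>

text \<open>Taking the filter as a parameter treats left, right and two-sided germs at once.
  Anchoring the line at \<open>f x\<close> builds in continuity at \<open>x\<close> along every
  \<Phi> \<le> \<open>at x\<close>.\<close>

definition pow2_germ :: "(real \<Rightarrow> real) \<Rightarrow> real \<Rightarrow> real filter \<Rightarrow> bool" where
  "pow2_germ f x \<Phi> \<longleftrightarrow> (\<exists>k::int. \<forall>\<^sub>F t in \<Phi>. f t = f x + 2 powi k * (t - x))"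

lemma pow2_germ_affine:
  assumes "\<forall>\<^sub>F t in \<Phi>. f t = 2 powi k * t + c" "f x = 2 powi k * x + c"
  shows "pow2_germ f x \<Phi>"
  unfolding pow2_germ_def
  by (intro exI[of _ k] eventually_mono[OF assms(1)]) (simp add: assms(2) algebra_simps)

text \<open>Chain rule: the germ of \<open>f\<close> at \<open>g x\<close> is pulled back along
  \<open>g\<close>, and the exponents of the two slopes add.\<close>

lemma pow2_germ_comp:
  assumes f: "pow2_germ f (g x) \<Psi>" and g: "pow2_germ g x \<Phi>" and lim: "filterlim g \<Psi> \<Phi>"
  shows "pow2_germ (f \<circ> g) x \<Phi>"
proof -
  obtain k where k: "\<forall>\<^sub>F t in \<Psi>. f t = f (g x) + 2 powi k * (t - g x)"
    using f unfolding pow2_germ_def by blast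
  obtain j where j: "\<forall>\<^sub>F t in \<Phi>. g t = g x + 2 powi j * (t - x)"
    using g unfolding pow2_germ_def by blast
  have "\<forall>\<^sub>F t in \<Phi>. f (g t) = f (g x) + 2 powi k * (g t - g x)"
    using filterlim_iff[THEN iffD1, OF lim] k by blast
  with j have "\<forall>\<^sub>F t in \<Phi>. (f \<circ> g) t = (f \<circ> g) x + 2 powi (k + j) * (t - x)"
    by eventually_elim (simp add: power_int_add)
  then show ?thesis
    unfolding pow2_germ_def by blast
qed

text \<open>Evaluating the germ of \<open>f\<close> at the argument \<open>g s\<close> and solving
  for \<open>g s\<close> gives an affine germ with the reciprocal slope.\<close>

lemma pow2_germ_inverse:
  assumes f: "pow2_germ f (g y) \<Phi>" and lim: "filterlim g \<Phi> \<Psi>" and fg: "\<And>t. f (g t) = t"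
  shows "pow2_germ g y \<Psi>"
proof -
  obtain k where k: "\<forall>\<^sub>F t in \<Phi>. f t = f (g y) + 2 powi k * (t - g y)"
    using f unfolding pow2_germ_def by blast
  have "\<forall>\<^sub>F s in \<Psi>. f (g s) = f (g y) + 2 powi k * (g s - g y)"
    using filterlim_iff[THEN iffD1, OF lim] k by blast
  then have "\<forall>\<^sub>F s in \<Psi>. g s = g y + 2 powi (- k) * (s - y)"
    by eventually_elim (simp add: fg power_int_minus field_simps)
  then show ?thesis
    unfolding pow2_germ_def by blast
qed

lemma pow2_germ_tendsto:
  assumes "pow2_germ f x \<Phi>" "\<Phi> \<le> at x"
  shows "(f \<longlongrightarrow> f x) \<Phi>"
proof -
  obtain k where k: "\<forall>\<^sub>F t in \<Phi>. f t = f x + 2 powi k * (t - x)"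
    using assms unfolding pow2_germ_def by blast
  have "((\<lambda>t. f x + 2 powi k * (t - x)) \<longlongrightarrow> f x + 2 powi k * (x - x)) (at x)"
    by (intro tendsto_intros)
  then have "((\<lambda>t. f x + 2 powi k * (t - x)) \<longlongrightarrow> f x) \<Phi>"
    using tendsto_mono[OF assms(2)] by simp
  then show ?thesis
    using tendsto_cong[OF k] by simp
qed

text \<open>Supplies the \<open>lim\<close> hypotheses of \<open>pow2_germ_comp\<close> and
  \<open>pow2_germ_inverse\<close>. Continuity gives the limit; strict monotonicity preserves the
  side of approach and keeps \<open>g t\<close> different from \<open>g x\<close>.\<close>

lemma strict_mono_filterlims:
  fixes g :: "real \<Rightarrow> real"
  assumes "strict_mono g" "isCont g x"
  shows "filterlim g (at_right (g x)) (at_right x)"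
    and "filterlim g (at_left (g x)) (at_left x)"
    and "filterlim g (at (g x)) (at x)"
proof -
  have lim: "(g \<longlongrightarrow> g x) (at x)"
    using assms(2) by (simp add: isCont_def)
  show "filterlim g (at_right (g x)) (at_right x)"
    by (rule tendsto_imp_filterlim_at_right)
      (auto intro: tendsto_mono[OF at_le lim] eventually_mono[OF eventually_at_right_less]
        strict_monoD[OF assms(1)])
  show "filterlim g (at_left (g x)) (at_left x)"
    by (rule tendsto_imp_filterlim_at_left)
      (auto simp: eventually_at_left_field intro: tendsto_mono[OF at_le lim] exI[of _ "x - 1"]
        strict_monoD[OF assms(1)])
  show "filterlim g (at (g x)) (at x)"
    using lim strict_mono_eq[OF assms(1)]
    by (auto simp: filterlim_at eventually_at_filter)
qed

section \<open>From breakpoints and slopes to germs, and back\<close>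

lemma not_breakpointI:
  assumes "affine_with_slope f m {a<..<b}" "a < x" "x < b"
  shows "x \<notin> breakpoints f"
proof -
  define e where "e = min (x - a) (b - x)"
  have "e > 0" "{x - e<..<x + e} \<subseteq> {a<..<b}"
    using assms(2,3) by (auto simp: e_def)
  then show ?thesis
    using assms(1) unfolding breakpoints_def affine_with_slope_def by blast
qed

lemma affine_on_interval:
  assumes "a < b" "\<And>x. a < x \<Longrightarrow> x < b \<Longrightarrow> x \<notin> breakpoints f"
  obtains m where "affine_with_slope f m {a<..<b}"
proof -
  \<comment> \<open>Slope and intercept of the line through the graph at \<open>t\<close>. Reading
    the slope off with \<open>deriv\<close> makes them functions of \<open>t\<close>; they are
    locally constant on the interval, hence constant because it is connected.\<close>
  define P where "P = (\<lambda>t. (deriv f t, f t - deriv f t * t))"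
  have loc: "\<forall>\<^sub>F t in at x within {a<..<b}. P x = P t" if x: "x \<in> {a<..<b}" for x
  proof -
    obtain e m c where e: "e > 0" and c: "\<And>t. t \<in> {x - e<..<x + e} \<Longrightarrow> f t = m * t + c"
      using assms(2)[of x] x unfolding breakpoints_def affine_with_slope_def by auto
    have d: "deriv f t = m" if t: "t \<in> {x - e<..<x + e}" for t
    proof (rule DERIV_imp_deriv)
      have "((\<lambda>t. m * t + c) has_field_derivative m) (at t)"
        by (auto intro!: derivative_eq_intros)
      moreover have "\<forall>\<^sub>F s in nhds t. f s = m * s + c"
        using c t by (auto intro!: eventually_nhds_in_open[THEN eventually_mono, of "{x - e<..<x + e}"])
      ultimately show "(f has_field_derivative m) (at t)"
        by (simp add: DERIV_cong_ev[of t t f "\<lambda>t. m * t + c"])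
    qed
    have "P t = (m, c)" if "t \<in> {x - e<..<x + e}" for t
      using d[OF that] c[OF that] by (simp add: P_def)
    moreover have "\<forall>\<^sub>F t in at x within {a<..<b}. t \<in> {x - e<..<x + e}"
      using e by (intro topological_tendstoD[OF tendsto_ident_at]) auto
    ultimately show ?thesis
      using e by (auto elim: eventually_mono)
  qed
  obtain x0 where x0: "x0 \<in> {a<..<b}"
    using assms(1) dense[of a b] by auto
  have "P t = P x0" if "t \<in> {a<..<b}" for t
    using connected_local_const[of "{a<..<b}" t x0 P] loc that x0 by auto
  then have "f t = deriv f x0 * t + (f x0 - deriv f x0 * x0)" if "t \<in> {a<..<b}" for t
    using that by (fastforce simp: P_def)
  then show ?thesis
    using that unfolding affine_with_slope_def by blast
qed

text \<open>The point \<open>x\<close> may be an endpoint of the interval, so the affine formula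
  need not cover it. Continuity does: along \<Phi> both \<open>f\<close> and the formula converge,
  to \<open>f x\<close> and to the value of the formula at \<open>x\<close>.\<close>

lemma one_sided_germ:
  assumes S: "slopes f \<subseteq> {2 powi k | k :: int. True}"
    and nb: "a < b" "\<And>t. a < t \<Longrightarrow> t < b \<Longrightarrow> t \<notin> breakpoints f"
    and x: "isCont f x" and \<Phi>: "\<Phi> \<le> at x" "\<Phi> \<noteq> bot" "\<forall>\<^sub>F t in \<Phi>. a < t \<and> t < b"
  shows "pow2_germ f x \<Phi>"
proof -
  obtain m where m: "affine_with_slope f m {a<..<b}"
    using affine_on_interval[OF nb] .
  then have "m \<in> slopes f"
    using nb(1) unfolding slopes_def by blast
  then obtain k where k: "m = 2 powi k"
    using S by auto
  obtain c where c: "\<And>t. a < t \<Longrightarrow> t < b \<Longrightarrow> f t = 2 powi k * t + c"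
    using m unfolding affine_with_slope_def k by auto
  have ev: "\<forall>\<^sub>F t in \<Phi>. f t = 2 powi k * t + c"
    using \<Phi>(3) by eventually_elim (auto intro: c)
  have "((\<lambda>t. 2 powi k * t + c) \<longlongrightarrow> 2 powi k * x + c) (at x)"
    by (intro tendsto_intros)
  then have "(f \<longlongrightarrow> 2 powi k * x + c) \<Phi>"
    using tendsto_mono[OF \<Phi>(1)] tendsto_cong[OF ev] by blast
  moreover have "(f \<longlongrightarrow> f x) \<Phi>"
    using x tendsto_mono[OF \<Phi>(1)] by (auto simp: isCont_def)
  ultimately have "f x = 2 powi k * x + c"
    using tendsto_unique[OF \<Phi>(2)] by blast
  then show ?thesis
    using ev by (rule pow2_germ_affine[rotated])
qed

text \<open>Unlike breakpoints and slopes, one-sided germs compose and invert pointwise, which makes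
  the group laws immediate.\<close>

definition germ_homeo :: "(real \<Rightarrow> real) \<Rightarrow> bool" where
  "germ_homeo f \<longleftrightarrow> strict_mono f \<and> surj f \<and>
    (\<forall>x. pow2_germ f x (at_right x)) \<and> (\<forall>x. pow2_germ f x (at_left x)) \<and>
    (\<forall>x. x \<notin> dyadic \<longrightarrow> pow2_germ f x (at x)) \<and>
    (\<forall>x. f x \<in> dyadic \<longleftrightarrow> x \<in> dyadic) \<and>
    (\<exists>r::int. \<forall>\<^sub>F t in at_top. f t = t + of_int r) \<and>
    (\<exists>l::int. \<forall>\<^sub>F t in at_bot. f t = t + of_int l)"

lemma germ_homeo_if_thompson:
  assumes "f \<in> thompson_homeos"
  shows "germ_homeo f"
proof -
  have hom: "\<exists>g. homeomorphism UNIV UNIV f g" and mono: "mono f" and cont: "continuous_on UNIV f"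
    and fin: "\<And>a b. finite (breakpoints f \<inter> {a..b})" and bd: "breakpoints f \<subseteq> dyadic"
    and S: "slopes f \<subseteq> {2 powi k | k :: int. True}" and dy: "f ` dyadic \<subseteq> dyadic"
    and ends: "\<exists>(l::int) (r::int) (M::real). M > 0 \<and>
        (\<forall>t. t > M \<longrightarrow> f t = t + of_int r) \<and> (\<forall>t. t < - M \<longrightarrow> f t = t + of_int l)"
    using assms unfolding thompson_homeos_def piecewise_linear_def by auto
  obtain g where "homeomorphism UNIV UNIV f g"
    using hom by blast
  then have "inj f" and surj: "surj f"
    by (auto simp: homeomorphism_def intro: inj_on_inverseI)
  then have smono: "strict_mono f"
    using mono by (simp add: strict_mono_iff_mono)
  have cont: "isCont f x" for x
    using cont continuous_on_eq_continuous_at by blast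
  \<comment> \<open>The breakpoints in \<open>{x - 1..x + 1}\<close> are finite in number, so they
    cannot accumulate at \<open>x\<close>; the point \<open>x\<close> itself may be one of
    them.\<close>
  have gap: "\<exists>e>0. \<forall>t. 0 < \<bar>t - x\<bar> \<and> \<bar>t - x\<bar> < e \<longrightarrow> t \<notin> breakpoints f" for x
  proof -
    have "\<not> x islimpt (breakpoints f \<inter> {x - 1..x + 1})"
      using islimpt_finite[OF fin] by blast
    then obtain e where "e > 0" "\<And>t. t \<noteq> x \<Longrightarrow> dist t x < e \<Longrightarrow> t \<notin> breakpoints f \<inter> {x - 1..x + 1}"
      unfolding islimpt_approachable by blast
    then show ?thesis
      by (intro exI[of _ "min e 1"]) (fastforce simp: dist_real_def abs_less_iff)
  qed
  have right: "pow2_germ f x (at_right x)" for x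
  proof -
    obtain e where "e > 0" "\<forall>t. 0 < \<bar>t - x\<bar> \<and> \<bar>t - x\<bar> < e \<longrightarrow> t \<notin> breakpoints f"
      using gap by blast
    then show ?thesis
      by (intro one_sided_germ[OF S _ _ cont, of x "x + e"])
        (auto intro: at_le simp: eventually_at_right_field intro: exI[of _ "x + e"])
  qed
  have left: "pow2_germ f x (at_left x)" for x
  proof -
    obtain e where "e > 0" "\<forall>t. 0 < \<bar>t - x\<bar> \<and> \<bar>t - x\<bar> < e \<longrightarrow> t \<notin> breakpoints f"
      using gap by blast
    then show ?thesis
      by (intro one_sided_germ[OF S _ _ cont, of "x - e" x])
        (auto intro: at_le simp: eventually_at_left_field intro: exI[of _ "x - e"])
  qed
  have two: "pow2_germ f x (at x)" if "x \<notin> dyadic" for x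
  proof -
    obtain e where "e > 0" "\<forall>t. 0 < \<bar>t - x\<bar> \<and> \<bar>t - x\<bar> < e \<longrightarrow> t \<notin> breakpoints f"
      using gap by blast
    moreover have "x \<notin> breakpoints f"
      using that bd by blast
    ultimately have e: "e > 0" "\<And>t. \<bar>t - x\<bar> < e \<Longrightarrow> t \<notin> breakpoints f"
      by fastforce+
    show ?thesis
      using e by (intro one_sided_germ[OF S _ _ cont, of "x - e" "x + e"])
        (auto simp: eventually_at dist_real_def intro: exI[of _ e])
  qed
  \<comment> \<open>The definition of \<open>thompson_homeos\<close> gives the forward implication;
    inverses call for this converse. A dyadic \<open>d\<close> on the affine piece to the right of
    \<open>x\<close> has a dyadic image, so \<open>x\<close> can be solved for in terms of dyadic
    numbers.\<close>
  have "x \<in> dyadic" if fx: "f x \<in> dyadic" for x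
  proof -
    obtain k b where b: "b > x" "\<And>t. x < t \<Longrightarrow> t < b \<Longrightarrow> f t = f x + 2 powi k * (t - x)"
      using right[of x] unfolding pow2_germ_def eventually_at_right_field by blast
    obtain d where d: "d \<in> dyadic" "x < d" "d < b"
      using dyadic_dense[OF b(1)] .
    have "x = d + 2 powi (- k) * (f x - f d)"
      using b(2)[OF d(2,3)] by (simp add: power_int_minus field_simps)
    moreover have "d + 2 powi (- k) * (f x - f d) \<in> dyadic"
      using fx d(1) dy by (intro dyadic_add dyadic_mult_pow2 dyadic_diff) auto
    ultimately show ?thesis
      by simp
  qed
  moreover have "\<exists>r::int. \<forall>\<^sub>F t in at_top. f t = t + of_int r"
    using ends eventually_at_top_dense by blast
  moreover have "\<exists>l::int. \<forall>\<^sub>F t in at_bot. f t = t + of_int l"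
    using ends eventually_at_bot_dense by blast
  ultimately show ?thesis
    using smono surj right left two dy unfolding germ_homeo_def by blast
qed

lemma germ_homeo_isCont:
  assumes "germ_homeo f"
  shows "isCont f x"
  using assms pow2_germ_tendsto[of f x] unfolding germ_homeo_def isCont_def
  by (simp add: filterlim_at_split at_le)

lemma thompson_if_germ_homeo:
  assumes f: "germ_homeo f"
  shows "f \<in> thompson_homeos"
proof -
  have smono: "strict_mono f" and surj: "surj f"
    and right: "\<And>x. pow2_germ f x (at_right x)" and left: "\<And>x. pow2_germ f x (at_left x)"
    and two: "\<And>x. x \<notin> dyadic \<Longrightarrow> pow2_germ f x (at x)"
    and dy: "\<And>x. f x \<in> dyadic \<longleftrightarrow> x \<in> dyadic"
    using f unfolding germ_homeo_def by auto
  have cont: "continuous_on UNIV f"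
    using germ_homeo_isCont[OF f] continuous_at_imp_continuous_on by blast
  have "\<exists>g. homeomorphism UNIV UNIV f g"
    using homeomorphism_into_1d[of UNIV f UNIV] cont surj strict_mono_imp_inj_on[OF smono] by auto
  moreover have "finite (breakpoints f \<inter> {a..b})" for a b
  proof (rule ccontr)
    \<comment> \<open>By compactness the breakpoints would accumulate at some \<open>x\<close>. But
      the right and left germs at \<open>x\<close> make \<open>f\<close> affine on an open interval
      on each side, and these contain no breakpoints.\<close>
    assume "infinite (breakpoints f \<inter> {a..b})"
    then obtain x where "x islimpt (breakpoints f \<inter> {a..b})"
      using compact_eq_Bolzano_Weierstrass[of "{a..b}"] compact_Icc by (metis inf_le2)
    then have "\<not> (\<forall>\<^sub>F t in at x. t \<notin> breakpoints f)"
      unfolding islimpt_iff_eventually by (metis (mono_tags, lifting) IntD1 eventually_mono)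
    moreover have "\<forall>\<^sub>F t in at_right x. t \<notin> breakpoints f"
    proof -
      obtain k b where b: "b > x" "\<And>t. x < t \<Longrightarrow> t < b \<Longrightarrow> f t = f x + 2 powi k * (t - x)"
        using right[of x] unfolding pow2_germ_def eventually_at_right_field by blast
      have "affine_with_slope f (2 powi k) {x<..<b}"
        unfolding affine_with_slope_def
        by (intro exI[of _ "f x - 2 powi k * x"]) (auto simp: b algebra_simps)
      then show ?thesis
        using not_breakpointI b(1) unfolding eventually_at_right_field by blast
    qed
    moreover have "\<forall>\<^sub>F t in at_left x. t \<notin> breakpoints f"
    proof -
      obtain k b where b: "b < x" "\<And>t. b < t \<Longrightarrow> t < x \<Longrightarrow> f t = f x + 2 powi k * (t - x)"
        using left[of x] unfolding pow2_germ_def eventually_at_left_field by blast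
      have "affine_with_slope f (2 powi k) {b<..<x}"
        unfolding affine_with_slope_def
        by (intro exI[of _ "f x - 2 powi k * x"]) (auto simp: b algebra_simps)
      then show ?thesis
        using not_breakpointI b(1) unfolding eventually_at_left_field by blast
    qed
    ultimately show False
      by (simp add: eventually_at_split)
  qed
  moreover have "breakpoints f \<subseteq> dyadic"
  proof (rule ccontr)
    assume "\<not> breakpoints f \<subseteq> dyadic"
    then obtain x where x: "x \<in> breakpoints f" "x \<notin> dyadic"
      by blast
    then obtain k where k: "\<forall>\<^sub>F t in at x. f t = f x + 2 powi k * (t - x)"
      using two unfolding pow2_germ_def by blast
    then obtain e where e: "e > 0" "\<And>t. t \<noteq> x \<Longrightarrow> dist t x < e \<Longrightarrow> f t = f x + 2 powi k * (t - x)"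
      unfolding eventually_at by blast
    then have "f t = f x + 2 powi k * (t - x)" if "t \<in> {x - e<..<x + e}" for t
      using that by (cases "t = x") (auto simp: dist_real_def)
    then have "affine_with_slope f (2 powi k) {x - e<..<x + e}"
      unfolding affine_with_slope_def
      by (intro exI[of _ "f x - 2 powi k * x"]) (auto simp: algebra_simps)
    then have "x \<notin> breakpoints f"
      using e(1) by (intro not_breakpointI) auto
    with x(1) show False
      by simp
  qed
  moreover have "slopes f \<subseteq> {2 powi k | k :: int. True}"
  proof
    fix m assume "m \<in> slopes f"
    then obtain a b c where ab: "a < b" and c: "\<And>t. a < t \<Longrightarrow> t < b \<Longrightarrow> f t = m * t + c"
      unfolding slopes_def affine_with_slope_def by auto
    obtain x where x: "a < x" "x < b"
      using dense[OF ab] by blast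
    \<comment> \<open>The right germ at an interior point \<open>x\<close> overlaps the given affine
      piece just after \<open>x\<close>, and on the overlap the two slopes must agree.\<close>
    obtain k d where d: "d > x" "\<And>t. x < t \<Longrightarrow> t < d \<Longrightarrow> f t = f x + 2 powi k * (t - x)"
      using right[of x] unfolding pow2_germ_def eventually_at_right_field by blast
    obtain t where t: "x < t" "t < min b d"
      using dense[of x "min b d"] x d(1) by auto
    have "m * (t - x) = 2 powi k * (t - x)"
      using c[of x] c[of t] d(2)[of t] x t by (simp add: algebra_simps)
    then show "m \<in> {2 powi k | k :: int. True}"
      using t by auto
  qed
  moreover have "\<exists>(l::int) (r::int) (M::real). M > 0 \<and>
        (\<forall>t. t > M \<longrightarrow> f t = t + of_int r) \<and> (\<forall>t. t < - M \<longrightarrow> f t = t + of_int l)"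
  proof -
    obtain r A where "\<And>t. t > A \<Longrightarrow> f t = t + of_int r"
      using f unfolding germ_homeo_def eventually_at_top_dense by blast
    moreover obtain l B where "\<And>t. t < B \<Longrightarrow> f t = t + of_int l"
      using f unfolding germ_homeo_def eventually_at_bot_dense by blast
    ultimately show ?thesis
      by (intro exI[of _ l] exI[of _ r] exI[of _ "max 1 (max A (- B))"]) auto
  qed
  ultimately show ?thesis
    using smono cont dy
    unfolding thompson_homeos_def piecewise_linear_def by (auto simp: strict_mono_mono)
qed

lemma thompson_homeos_iff: "f \<in> thompson_homeos \<longleftrightarrow> germ_homeo f"
  using germ_homeo_if_thompson thompson_if_germ_homeo by blast

section \<open>Composition and inversion of germ homeomorphisms\<close>

lemma strict_mono_surj_filterlim:
  fixes f :: "real \<Rightarrow> real"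
  assumes "strict_mono f" "surj f"
  shows "filterlim f at_top at_top" "filterlim f at_bot at_bot"
proof -
  have le: "f x \<le> f y \<longleftrightarrow> x \<le> y" for x y
    using strict_mono_less_eq[OF assms(1)] .
  show "filterlim f at_top at_top"
    unfolding filterlim_at_top eventually_at_top_linorder
    using assms(2) le by (metis surj_def)
  show "filterlim f at_bot at_bot"
    unfolding filterlim_at_bot eventually_at_bot_linorder
    using assms(2) le by (metis surj_def)
qed

text \<open>The filter \<Phi> stands for an end of the line; the limit hypothesis allows the formula
  for \<open>f\<close> to be evaluated at \<open>g t\<close>.\<close>

lemma eventually_translation_comp:
  fixes f g :: "real \<Rightarrow> real"
  assumes "\<forall>\<^sub>F t in \<Phi>. f t = t + r" "\<forall>\<^sub>F t in \<Phi>. g t = t + s" "filterlim g \<Phi> \<Phi>"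
  shows "\<forall>\<^sub>F t in \<Phi>. (f \<circ> g) t = t + (r + s)"
proof -
  have "\<forall>\<^sub>F t in \<Phi>. f (g t) = g t + r"
    using filterlim_iff[THEN iffD1, OF assms(3)] assms(1) by blast
  with assms(2) show ?thesis
    by eventually_elim simp
qed

lemma eventually_translation_inverse:
  fixes f g :: "real \<Rightarrow> real"
  assumes "\<forall>\<^sub>F t in \<Phi>. f t = t + r" "\<And>t. f (g t) = t" "filterlim g \<Phi> \<Phi>"
  shows "\<forall>\<^sub>F t in \<Phi>. g t = t + - r"
proof -
  have "\<forall>\<^sub>F t in \<Phi>. f (g t) = g t + r"
    using filterlim_iff[THEN iffD1, OF assms(3)] assms(1) by blast
  then show ?thesis
    by eventually_elim (simp add: assms(2))
qed

lemma germ_homeo_comp: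
  assumes f: "germ_homeo f" and g: "germ_homeo g"
  shows "germ_homeo (f \<circ> g)"
proof -
  have smf: "strict_mono f" and smg: "strict_mono g" and sf: "surj f" and sg: "surj g"
    using assms by (auto simp: germ_homeo_def)
  note lims = strict_mono_filterlims[OF smg germ_homeo_isCont[OF g]]
  obtain r s l m :: int where
    r: "\<forall>\<^sub>F t in at_top. f t = t + of_int r" and s: "\<forall>\<^sub>F t in at_top. g t = t + of_int s" and
    l: "\<forall>\<^sub>F t in at_bot. f t = t + of_int l" and m: "\<forall>\<^sub>F t in at_bot. g t = t + of_int m"
    using assms unfolding germ_homeo_def by blast
  have "\<forall>\<^sub>F t in at_top. (f \<circ> g) t = t + of_int (r + s)"
    using eventually_translation_comp[OF r s strict_mono_surj_filterlim(1)[OF smg sg]] by simp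
  moreover have "\<forall>\<^sub>F t in at_bot. (f \<circ> g) t = t + of_int (l + m)"
    using eventually_translation_comp[OF l m strict_mono_surj_filterlim(2)[OF smg sg]] by simp
  moreover have "strict_mono (f \<circ> g)"
    using smf smg by (simp add: strict_mono_def)
  moreover have "surj (f \<circ> g)"
    using sf sg comp_surj by blast
  moreover have "pow2_germ (f \<circ> g) x (at_right x)" "pow2_germ (f \<circ> g) x (at_left x)"
    "x \<notin> dyadic \<Longrightarrow> pow2_germ (f \<circ> g) x (at x)" for x
    using f g by (auto simp: germ_homeo_def intro!: pow2_germ_comp[OF _ _ lims(1)]
      pow2_germ_comp[OF _ _ lims(2)] pow2_germ_comp[OF _ _ lims(3)])
  moreover have "(f \<circ> g) x \<in> dyadic \<longleftrightarrow> x \<in> dyadic" for x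
    using f g by (simp add: germ_homeo_def)
  ultimately show ?thesis
    unfolding germ_homeo_def by blast
qed

lemma germ_homeo_inv:
  assumes f: "germ_homeo f"
  shows "germ_homeo (inv_into UNIV f)"
proof -
  have sm: "strict_mono f" and sf: "surj f"
    using assms by (auto simp: germ_homeo_def)
  have inj: "inj f"
    using strict_mono_imp_inj_on[OF sm] .
  have fi: "f (inv_into UNIV f t) = t" for t
    using surj_f_inv_f[OF sf] .
  have smi: "strict_mono (inv_into UNIV f)"
    unfolding strict_mono_def using strict_mono_less[OF sm] by (metis fi)
  have si: "surj (inv_into UNIV f)"
    using inj by (simp add: inj_imp_surj_inv)
  have cont: "isCont (inv_into UNIV f) y" for y
  proof -
    have "isCont (inv_into UNIV f) (f (inv_into UNIV f y))"
      using germ_homeo_isCont[OF f] inv_f_f[OF inj]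
      by (intro isCont_inverse_function[where f = f and d = 1]) auto
    then show ?thesis
      by (simp add: fi)
  qed
  note lims = strict_mono_filterlims[OF smi cont]
  obtain r l :: int where
    r: "\<forall>\<^sub>F t in at_top. f t = t + of_int r" and l: "\<forall>\<^sub>F t in at_bot. f t = t + of_int l"
    using assms unfolding germ_homeo_def by blast
  have "\<forall>\<^sub>F t in at_top. inv_into UNIV f t = t + of_int (- r)"
    using eventually_translation_inverse[OF r fi strict_mono_surj_filterlim(1)[OF smi si]] by simp
  moreover have "\<forall>\<^sub>F t in at_bot. inv_into UNIV f t = t + of_int (- l)"
    using eventually_translation_inverse[OF l fi strict_mono_surj_filterlim(2)[OF smi si]] by simp
  \<comment> \<open>The equivalence in \<open>germ_homeo\<close> is symmetric between
    \<open>f\<close> and its inverse. It also sends a non-dyadic \<open>y\<close> to a non-dyadic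
    preimage, where \<open>f\<close> has a two-sided germ to invert.\<close>
  moreover have dy: "inv_into UNIV f y \<in> dyadic \<longleftrightarrow> y \<in> dyadic" for y
    using f fi[of y] unfolding germ_homeo_def by metis
  moreover have "pow2_germ (inv_into UNIV f) y (at_right y)"
    "pow2_germ (inv_into UNIV f) y (at_left y)"
    "y \<notin> dyadic \<Longrightarrow> pow2_germ (inv_into UNIV f) y (at y)" for y
    using f dy by (auto simp: germ_homeo_def intro!: pow2_germ_inverse[OF _ lims(1) fi]
      pow2_germ_inverse[OF _ lims(2) fi] pow2_germ_inverse[OF _ lims(3) fi])
  ultimately show ?thesis
    using smi si unfolding germ_homeo_def by blast
qed

lemma germ_homeo_shift: "germ_homeo (\<lambda>t. t + of_int n)"
proof -
  have "pow2_germ (\<lambda>t. t + of_int n) x \<Phi>" for x \<Phi>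
    by (rule pow2_germ_affine[where k = 0 and c = "of_int n"]) auto
  moreover have "x + of_int n \<in> dyadic \<longleftrightarrow> x \<in> dyadic" for x
    using dyadic_add[of x "of_int n"] dyadic_diff[of "x + of_int n" "of_int n"] by auto
  moreover have "surj (\<lambda>t. t + of_int n :: real)"
    by (rule surjI[of _ "\<lambda>t. t - of_int n"]) simp
  ultimately show ?thesis
    unfolding germ_homeo_def by (auto simp: strict_mono_def)
qed

section \<open>An explicit element that translates only one end\<close>

text \<open>The prototype for realising translation near +\<infinity> while fixing a half-line:
  slope 2 on [0,1] creates the unit gap between the identity and the translation by 1.\<close>

definition half_shift :: "real \<Rightarrow> real" where
  "half_shift t = (if t \<le> 0 then t else if t \<le> 1 then 2 * t else t + 1)"

lemma germ_homeo_half_shift: "germ_homeo half_shift"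
proof -
  \<comment> \<open>The pieces are closed, so that 0 and 1 belong to both neighbouring pieces and
    can serve as base point for either one-sided germ.\<close>
  have germ: "pow2_germ half_shift x \<Phi>"
    if "x \<in> S" "\<forall>\<^sub>F t in \<Phi>. t \<in> S" "S = {..0} \<or> S = {0..1} \<or> S = {1..}" for x S \<Phi>
    using that(3)
  proof (elim disjE)
    assume S: "S = {..0}"
    show ?thesis
      using that(1) by (intro pow2_germ_affine[where k = 0 and c = 0] eventually_mono[OF that(2)])
        (auto simp: half_shift_def S)
  next
    assume S: "S = {0..1}"
    show ?thesis
      using that(1) by (intro pow2_germ_affine[where k = 1 and c = 0] eventually_mono[OF that(2)])
        (auto simp: half_shift_def S)
  next
    assume S: "S = {1..}"
    show ?thesis
      using that(1) by (intro pow2_germ_affine[where k = 0 and c = 1] eventually_mono[OF that(2)])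
        (auto simp: half_shift_def S)
  qed
  have right: "pow2_germ half_shift x (at_right x)" for x
  proof -
    consider "x < 0" | "0 \<le> x" "x < 1" | "1 \<le> x"
      by linarith
    then show ?thesis
    proof cases
      case 1
      then show ?thesis
        by (intro germ[of _ "{..0}"]) (auto simp: eventually_at_right_field intro: exI[of _ 0])
    next
      case 2
      then show ?thesis
        by (intro germ[of _ "{0..1}"]) (auto simp: eventually_at_right_field intro: exI[of _ 1])
    next
      case 3
      then show ?thesis
        by (intro germ[of _ "{1..}"]) (auto simp: eventually_at_right_field intro: exI[of _ "x + 1"])
    qed
  qed
  have left: "pow2_germ half_shift x (at_left x)" for x
  proof -
    consider "x \<le> 0" | "0 < x" "x \<le> 1" | "1 < x"
      by linarith
    then show ?thesis
    proof cases
      case 1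
      then show ?thesis
        by (intro germ[of _ "{..0}"]) (auto simp: eventually_at_left_field intro: exI[of _ "x - 1"])
    next
      case 2
      then show ?thesis
        by (intro germ[of _ "{0..1}"]) (auto simp: eventually_at_left_field intro: exI[of _ 0])
    next
      case 3
      then show ?thesis
        by (intro germ[of _ "{1..}"]) (auto simp: eventually_at_left_field intro: exI[of _ 1])
    qed
  qed
  have two: "pow2_germ half_shift x (at x)" if "x \<notin> dyadic" for x
  proof -
    \<comment> \<open>The two bends sit at dyadic points, so a non-dyadic \<open>x\<close> is
      interior to one piece.\<close>
    have "x \<noteq> 0" "x \<noteq> 1"
      using that dyadic_of_int[of 0] dyadic_of_int[of 1] by auto
    then consider "x < 0" | "0 < x" "x < 1" | "1 < x"
      by linarith
    then show ?thesis
    proof cases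
      case 1
      then have "\<forall>\<^sub>F t in at x. t \<in> {..<0}"
        by (intro topological_tendstoD[OF tendsto_ident_at]) auto
      with 1 show ?thesis
        by (intro germ[of _ "{..0}"]) (auto elim: eventually_mono)
    next
      case 2
      then have "\<forall>\<^sub>F t in at x. t \<in> {0<..<1}"
        by (intro topological_tendstoD[OF tendsto_ident_at]) auto
      with 2 show ?thesis
        by (intro germ[of _ "{0..1}"]) (auto elim: eventually_mono)
    next
      case 3
      then have "\<forall>\<^sub>F t in at x. t \<in> {1<..}"
        by (intro topological_tendstoD[OF tendsto_ident_at]) auto
      with 3 show ?thesis
        by (intro germ[of _ "{1..}"]) (auto elim: eventually_mono)
    qed
  qed
  have "half_shift x \<in> dyadic \<longleftrightarrow> x \<in> dyadic" for x
  proof -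
    have "2 * x \<in> dyadic \<longleftrightarrow> x \<in> dyadic"
      using dyadic_mult_pow2[of x 1] dyadic_mult_pow2[of "2 * x" "- 1"]
      by (auto simp: power_int_minus)
    moreover have "x + 1 \<in> dyadic \<longleftrightarrow> x \<in> dyadic"
      using dyadic_add[of x 1] dyadic_diff[of "x + 1" 1] dyadic_of_int[of 1] by auto
    ultimately show ?thesis
      by (simp add: half_shift_def)
  qed
  moreover have "strict_mono half_shift"
    unfolding strict_mono_def half_shift_def by (intro allI impI) (simp split: if_split)
  moreover have "surj half_shift"
  proof (rule surjI)
    show "half_shift (if t \<le> 0 then t else if t \<le> 2 then t / 2 else t - 1) = t" for t
      by (auto simp: half_shift_def)
  qed
  moreover have "\<forall>\<^sub>F t in at_top. half_shift t = t + of_int 1"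
    unfolding eventually_at_top_dense by (intro exI[of _ 1]) (auto simp: half_shift_def)
  moreover have "\<forall>\<^sub>F t in at_bot. half_shift t = t + of_int 0"
    unfolding eventually_at_bot_dense by (intro exI[of _ 0]) (auto simp: half_shift_def)
  ultimately show ?thesis
    using right left two unfolding germ_homeo_def by blast
qed

section \<open>Commutators in abstract groups\<close>

text \<open>Pigeonhole: among finitely many cosets two distinct powers of \<open>x\<close> share
  one, and their quotient is a positive power of \<open>x\<close> in \<open>H\<close>.\<close>

lemma (in group) finite_index_pow_mem:
  assumes H: "subgroup H G" and fin: "finite (rcosets H)" and x: "x \<in> carrier G"
  shows "\<exists>n::nat>0. x [^] n \<in> H"
proof -
  have "(\<lambda>i::nat. H #> x [^] i) ` UNIV \<subseteq> rcosets H"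
    using x H rcosetsI[OF subgroup.subset[OF H]] by auto
  then have "\<not> inj (\<lambda>i::nat. H #> x [^] i)"
    using fin finite_subset finite_imageD by blast
  then obtain i j :: nat where ij: "i < j" "H #> x [^] i = H #> x [^] j"
    unfolding inj_def by (metis linorder_neqE_nat)
  have "x [^] j \<otimes> inv (x [^] i) \<in> H"
    using ij(2) rcos_self[OF _ H, of "x [^] j"] subgroup.rcos_module_imp[OF H is_group, of "x [^] i"] x
    by auto
  moreover have "x [^] j = x [^] (j - i) \<otimes> x [^] i"
    using ij(1) x by (simp add: nat_pow_mult)
  ultimately have "x [^] (j - i) \<in> H"
    using x by (simp add: m_assoc)
  then show ?thesis
    using ij(1) by (intro exI[of _ "j - i"]) auto
qed

lemma (in group) conj_nat_pow:
  assumes "g \<in> carrier G" "x \<in> carrier G"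
  shows "(g \<otimes> x \<otimes> inv g) [^] (n::nat) = g \<otimes> x [^] n \<otimes> inv g"
proof (induction n)
  case (Suc n)
  have cancel: "inv g \<otimes> (g \<otimes> y) = y" if "y \<in> carrier G" for y
    using that assms(1) by (simp flip: m_assoc)
  have "(g \<otimes> x \<otimes> inv g) [^] Suc n = (g \<otimes> x [^] n \<otimes> inv g) \<otimes> (g \<otimes> x \<otimes> inv g)"
    using Suc by simp
  then show ?case
    using assms by (simp add: m_assoc cancel)
qed (use assms in simp)

lemma (in group) commutator_eq:
  assumes "x \<in> carrier G" "y \<in> carrier G"
  shows "x \<otimes> y \<otimes> inv x \<otimes> inv y = (x \<otimes> y) \<otimes> inv (y \<otimes> x)"
  using assms by (simp add: inv_mult_group m_assoc)

text \<open>Serves both for products of a central and a commuting factor in a quotient and for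
  products of powers of two commuting elements.\<close>

lemma (in group) products_commute:
  assumes "p \<in> carrier G" "q \<in> carrier G" "r \<in> carrier G" "s \<in> carrier G"
    and pr: "p \<otimes> r = r \<otimes> p" and qs: "q \<otimes> s = s \<otimes> q"
    and qr: "q \<otimes> r = r \<otimes> q" and ps: "p \<otimes> s = s \<otimes> p"
  shows "(p \<otimes> q) \<otimes> (r \<otimes> s) = (r \<otimes> s) \<otimes> (p \<otimes> q)"
proof -
  have "(p \<otimes> q) \<otimes> (r \<otimes> s) = p \<otimes> (q \<otimes> r) \<otimes> s"
    using assms(1-4) by (simp add: m_assoc)
  also have "\<dots> = (p \<otimes> r) \<otimes> (q \<otimes> s)"
    using assms(1-4) by (simp add: m_assoc qr)
  also have "\<dots> = r \<otimes> (p \<otimes> s) \<otimes> q"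
    using assms(1-4) by (simp add: m_assoc pr qs)
  also have "\<dots> = (r \<otimes> s) \<otimes> (p \<otimes> q)"
    using assms(1-4) by (simp add: m_assoc ps)
  finally show ?thesis .
qed

text \<open>The two products (hk)(fe) and (fe)(hk) equal (hf)(ke) and (fh)(ke), so the common factor
  ke cancels in their quotient. It discards factors supported far away; with \<open>k\<close>
  trivial it discards a correction of \<open>f\<close> alone.\<close>

lemma (in group) commutator_absorb:
  assumes "h \<in> carrier G" "k \<in> carrier G" "f \<in> carrier G" "e \<in> carrier G"
    and "k \<otimes> f = f \<otimes> k" "e \<otimes> h = h \<otimes> e" "k \<otimes> e = e \<otimes> k"
  shows "(h \<otimes> k) \<otimes> (f \<otimes> e) \<otimes> inv (h \<otimes> k) \<otimes> inv (f \<otimes> e) = h \<otimes> f \<otimes> inv h \<otimes> inv f"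
proof -
  have "(h \<otimes> k) \<otimes> (f \<otimes> e) = h \<otimes> (k \<otimes> f) \<otimes> e"
    using assms(1-4) by (simp add: m_assoc)
  then have 1: "(h \<otimes> k) \<otimes> (f \<otimes> e) = (h \<otimes> f) \<otimes> (k \<otimes> e)"
    using assms(1-4) by (simp add: m_assoc assms(5))
  have "(f \<otimes> e) \<otimes> (h \<otimes> k) = f \<otimes> (e \<otimes> h) \<otimes> k"
    using assms(1-4) by (simp add: m_assoc)
  then have 2: "(f \<otimes> e) \<otimes> (h \<otimes> k) = (f \<otimes> h) \<otimes> (k \<otimes> e)"
    using assms(1-4) by (simp add: m_assoc assms(6,7))
  have "(h \<otimes> k) \<otimes> (f \<otimes> e) \<otimes> inv (h \<otimes> k) \<otimes> inv (f \<otimes> e)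
      = ((h \<otimes> k) \<otimes> (f \<otimes> e)) \<otimes> inv ((f \<otimes> e) \<otimes> (h \<otimes> k))"
    using assms(1-4) by (intro commutator_eq m_closed)
  also have "\<dots> = ((h \<otimes> f) \<otimes> (k \<otimes> e)) \<otimes> inv ((f \<otimes> h) \<otimes> (k \<otimes> e))"
    unfolding 1 2 ..
  also have "\<dots> = (h \<otimes> f) \<otimes> ((k \<otimes> e) \<otimes> inv (k \<otimes> e)) \<otimes> inv (f \<otimes> h)"
    using assms(1-4) by (simp add: inv_mult_group m_assoc del: r_inv)
  also have "\<dots> = h \<otimes> f \<otimes> inv h \<otimes> inv f"
    using assms(1-4) by (simp add: commutator_eq)
  finally show ?thesis .
qed

text \<open>The commutator is the quotient of xy by yx, so it lies in \<open>D\<close> exactly when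
  these two products have the same coset.\<close>

lemma (in group) commutator_mem_normal_iff:
  assumes D: "D \<lhd> G" and x: "x \<in> carrier G" "y \<in> carrier G"
  shows "x \<otimes> y \<otimes> inv x \<otimes> inv y \<in> D \<longleftrightarrow>
    (D #> x) \<otimes>\<^bsub>G Mod D\<^esub> (D #> y) = (D #> y) \<otimes>\<^bsub>G Mod D\<^esub> (D #> x)"
proof -
  have sub: "subgroup D G"
    using D normal_imp_subgroup by blast
  have "x \<otimes> y \<otimes> inv x \<otimes> inv y \<in> D \<longleftrightarrow> x \<otimes> y \<in> D #> (y \<otimes> x)"
    using x by (simp add: commutator_eq subgroup.rcos_module[OF sub is_group])
  also have "\<dots> \<longleftrightarrow> D #> (x \<otimes> y) = D #> (y \<otimes> x)"
    using repr_independence[OF _ _ sub] rcos_self[OF _ sub] x by (metis m_closed)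
  finally show ?thesis
    using normal.rcos_sum[OF D] x by simp
qed

text \<open>In \<open>G Mod D\<close> the images of \<open>C\<close> are central and those of
  \<open>A\<close> commute with one another, so any two products of the form ca commute there: the
  quotient is abelian.\<close>

lemma (in group) derived_subset_if_central_times_abelian:
  assumes D: "D \<lhd> G" and C: "C \<subseteq> carrier G" and A: "A \<subseteq> carrier G"
    and central: "\<And>c g. c \<in> C \<Longrightarrow> g \<in> carrier G \<Longrightarrow> c \<otimes> g \<otimes> inv c \<otimes> inv g \<in> D"
    and abelian: "\<And>a b. a \<in> A \<Longrightarrow> b \<in> A \<Longrightarrow> a \<otimes> b = b \<otimes> a"
    and decomp: "\<And>g. g \<in> carrier G \<Longrightarrow> \<exists>c\<in>C. \<exists>a\<in>A. g = c \<otimes> a"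
  shows "derived G (carrier G) \<subseteq> D"
proof -
  have sub: "subgroup D G"
    using D normal_imp_subgroup by blast
  interpret Q: group "G Mod D"
    using D by (rule normal.factorgroup_is_group)
  define \<pi> where "\<pi> = (\<lambda>x. D #> x)"
  have \<pi>: "\<pi> x \<in> carrier (G Mod D)" if "x \<in> carrier G" for x
    using that by (auto simp: \<pi>_def carrier_FactGroup)
  have mult: "\<pi> (x \<otimes> y) = \<pi> x \<otimes>\<^bsub>G Mod D\<^esub> \<pi> y" if "x \<in> carrier G" "y \<in> carrier G" for x y
    using normal.rcos_sum[OF D that] by (simp add: \<pi>_def)
  have "x \<otimes> y \<otimes> inv x \<otimes> inv y \<in> D" if xy: "x \<in> carrier G" "y \<in> carrier G" for x y
  proof -
    obtain c a d b where x: "x = c \<otimes> a" "c \<in> C" "a \<in> A" and y: "y = d \<otimes> b" "d \<in> C" "b \<in> A"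
      using decomp[OF xy(1)] decomp[OF xy(2)] by blast
    have car: "c \<in> carrier G" "a \<in> carrier G" "d \<in> carrier G" "b \<in> carrier G"
      using x y A C by auto
    have "\<pi> c \<otimes>\<^bsub>G Mod D\<^esub> \<pi> g = \<pi> g \<otimes>\<^bsub>G Mod D\<^esub> \<pi> c" if "c \<in> C" "g \<in> carrier G" for c g
      using central[OF that] commutator_mem_normal_iff[OF D] that C unfolding \<pi>_def by blast
    moreover have "\<pi> a \<otimes>\<^bsub>G Mod D\<^esub> \<pi> b = \<pi> b \<otimes>\<^bsub>G Mod D\<^esub> \<pi> a"
      using abelian[OF x(3) y(3)] mult car by metis
    ultimately have "\<pi> x \<otimes>\<^bsub>G Mod D\<^esub> \<pi> y = \<pi> y \<otimes>\<^bsub>G Mod D\<^esub> \<pi> x"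
      unfolding x(1) y(1) mult[OF car(1,2)] mult[OF car(3,4)]
      using x y car \<pi> by (intro Q.products_commute) auto
    then show ?thesis
      using commutator_mem_normal_iff[OF D xy] by (simp add: \<pi>_def)
  qed
  then have "derived_set G (carrier G) \<subseteq> D"
    by auto
  then show ?thesis
    unfolding derived_def using generate_subgroup_incl[OF _ sub] by blast
qed

section \<open>The group structure and compactly supported elements\<close>

lemma thompson_F_simps [simp]:
  "carrier thompson_F = thompson_homeos" "f \<otimes>\<^bsub>thompson_F\<^esub> g = f \<circ> g" "\<one>\<^bsub>thompson_F\<^esub> = id"
  by (simp_all add: thompson_F_def)

lemma thompson_bij: "f \<in> thompson_homeos \<Longrightarrow> bij f"
  by (auto simp: thompson_homeos_iff germ_homeo_def bij_def intro: strict_mono_imp_inj_on)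

lemma group_thompson_F: "group thompson_F"
proof (rule groupI)
  show "\<one>\<^bsub>thompson_F\<^esub> \<in> carrier thompson_F"
    using germ_homeo_shift[of 0] by (simp add: thompson_homeos_iff id_def)
  show "f \<otimes>\<^bsub>thompson_F\<^esub> g \<in> carrier thompson_F"
    if "f \<in> carrier thompson_F" "g \<in> carrier thompson_F" for f g
    using that germ_homeo_comp by (simp add: thompson_homeos_iff)
  show "\<exists>g\<in>carrier thompson_F. g \<otimes>\<^bsub>thompson_F\<^esub> f = \<one>\<^bsub>thompson_F\<^esub>"
    if "f \<in> carrier thompson_F" for f
    using that germ_homeo_inv[of f] bij_is_inj[OF thompson_bij, of f]
    by (intro bexI[of _ "inv_into UNIV f"]) (auto simp: thompson_homeos_iff)
qed (auto simp: comp_assoc)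

interpretation thompson: group thompson_F
  by (rule group_thompson_F)

lemma thompson_inv_eq:
  assumes "f \<in> thompson_homeos"
  shows "inv\<^bsub>thompson_F\<^esub> f = inv_into UNIV f"
proof (rule thompson.inv_equality)
  show "inv_into UNIV f \<otimes>\<^bsub>thompson_F\<^esub> f = \<one>\<^bsub>thompson_F\<^esub>"
    using bij_is_inj[OF thompson_bij[OF assms]] by auto
qed (use assms germ_homeo_inv in \<open>auto simp: thompson_homeos_iff\<close>)

lemma thompson_apply_inv:
  assumes "f \<in> thompson_homeos"
  shows "f ((inv\<^bsub>thompson_F\<^esub> f) t) = t"
  using thompson_inv_eq[OF assms] thompson_bij[OF assms] by (simp add: bij_is_surj surj_f_inv_f)

lemma thompson_inv_fixes:
  assumes "f \<in> thompson_homeos" "f t = t"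
  shows "(inv\<^bsub>thompson_F\<^esub> f) t = t"
  using thompson_inv_eq[OF assms(1)] thompson_bij[OF assms(1)] assms(2)
  by (metis bij_inv_eq_iff)

lemma thompson_filterlim:
  assumes "f \<in> thompson_homeos" "\<Phi> = at_top \<or> \<Phi> = at_bot"
  shows "filterlim f \<Phi> \<Phi>"
  using assms strict_mono_surj_filterlim[of f] by (auto simp: thompson_homeos_iff germ_homeo_def)

lemma thompson_translation_comp:
  assumes "g \<in> thompson_homeos" "\<Phi> = at_top \<or> \<Phi> = at_bot"
    and "\<forall>\<^sub>F t in \<Phi>. f t = t + r" "\<forall>\<^sub>F t in \<Phi>. g t = t + s"
  shows "\<forall>\<^sub>F t in \<Phi>. (f \<circ> g) t = t + (r + s)"
  using eventually_translation_comp[OF assms(3,4) thompson_filterlim[OF assms(1,2)]] .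

lemma thompson_translation_inv:
  assumes "f \<in> thompson_homeos" "\<Phi> = at_top \<or> \<Phi> = at_bot" "\<forall>\<^sub>F t in \<Phi>. f t = t + r"
  shows "\<forall>\<^sub>F t in \<Phi>. (inv\<^bsub>thompson_F\<^esub> f) t = t + - r"
  using assms thompson.inv_closed[of f]
  by (intro eventually_translation_inverse[where f = f] thompson_filterlim thompson_apply_inv) auto

lemma thompson_translation_int_pow:
  assumes f: "f \<in> thompson_homeos" and \<Phi>: "\<Phi> = at_top \<or> \<Phi> = at_bot"
    and ev: "\<forall>\<^sub>F t in \<Phi>. f t = t + r"
  shows "\<forall>\<^sub>F t in \<Phi>. (f [^]\<^bsub>thompson_F\<^esub> (k::int)) t = t + of_int k * r"
proof -
  have nat: "\<forall>\<^sub>F t in \<Phi>. (f [^]\<^bsub>thompson_F\<^esub> (n::nat)) t = t + of_nat n * r" for n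
  proof (induction n)
    case (Suc n)
    show ?case
      using thompson_translation_comp[OF f \<Phi> Suc ev] by (simp add: algebra_simps)
  qed simp
  have "f [^]\<^bsub>thompson_F\<^esub> n \<in> thompson_homeos" for n :: nat
    using thompson.nat_pow_closed[of f n] f by simp
  then have "\<forall>\<^sub>F t in \<Phi>. (inv\<^bsub>thompson_F\<^esub> (f [^]\<^bsub>thompson_F\<^esub> n)) t = t + - (of_nat n * r)" for n
    using thompson_translation_inv[OF _ \<Phi> nat] by blast
  with nat show ?thesis
    using f by (cases k rule: int_cases2)
      (auto simp: int_pow_int thompson.int_pow_neg simp del: thompson_F_simps(2))
qed

lemma thompson_int_pow_fixes:
  assumes f: "f \<in> thompson_homeos" and "f t = t"
  shows "(f [^]\<^bsub>thompson_F\<^esub> (k::int)) t = t"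
proof -
  have nat: "(f [^]\<^bsub>thompson_F\<^esub> n) t = t" for n :: nat
    by (induction n) (use assms in auto)
  have "f [^]\<^bsub>thompson_F\<^esub> n \<in> thompson_homeos" for n :: nat
    using thompson.nat_pow_closed[of f n] f by simp
  with nat show ?thesis
    using f thompson_inv_fixes by (cases k rule: int_cases2)
      (auto simp: int_pow_int thompson.int_pow_neg simp del: thompson_F_simps(2))
qed

section \<open>Disjoint and compact supports\<close>

text \<open>If \<open>f\<close> moves \<open>t\<close>, injectivity makes it move \<open>f t\<close>
  too, so \<open>g\<close> fixes both points and both composites send \<open>t\<close> to
  \<open>f t\<close>. The case where \<open>g\<close> moves \<open>t\<close> is symmetric.\<close>

lemma disjoint_support_commute:
  assumes "inj f" "inj g" "\<And>t. f t = t \<or> g t = t"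
  shows "f \<circ> g = g \<circ> f"
proof
  fix t
  show "(f \<circ> g) t = (g \<circ> f) t"
    using assms(3)[of t] assms(3)[of "f t"] assms(3)[of "g t"] injD[OF assms(1)] injD[OF assms(2)]
    by (metis comp_apply)
qed

lemma thompson_disjoint_support_commute:
  assumes "f \<in> thompson_homeos" "g \<in> thompson_homeos" "\<And>t. f t = t \<or> g t = t"
  shows "f \<circ> g = g \<circ> f"
  using assms by (intro disjoint_support_commute bij_is_inj thompson_bij)

text \<open>Compact support is phrased as translation length 0 at both ends, so that the additivity
  of translation lengths applies directly.\<close>

definition compactly_supported :: "(real \<Rightarrow> real) set" where
  "compactly_supported = {f \<in> thompson_homeos.
     (\<forall>\<^sub>F t in at_top. f t = t) \<and> (\<forall>\<^sub>F t in at_bot. f t = t)}"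

lemma compactly_supported_bound:
  assumes "f \<in> compactly_supported"
  shows "\<exists>M>0. \<forall>t. \<bar>t\<bar> > M \<longrightarrow> f t = t"
proof -
  obtain A where A: "\<And>t. t > A \<Longrightarrow> f t = t"
    using assms unfolding compactly_supported_def eventually_at_top_dense by blast
  obtain B where B: "\<And>t. t < B \<Longrightarrow> f t = t"
    using assms unfolding compactly_supported_def eventually_at_bot_dense by blast
  have "f t = t" if "\<bar>t\<bar> > max 1 (max A (- B))" for t
    using that A[of t] B[of t] by (auto simp: abs_if split: if_splits)
  then show ?thesis
    by (intro exI[of _ "max 1 (max A (- B))"]) auto
qed

text \<open>Translation lengths at each end are additive under composition and change sign under
  inversion. Conjugation by an element of length \<open>r\<close> therefore yields r + 0 - r =
  0.\<close>

lemma compactly_supported_normal: "compactly_supported \<lhd> thompson_F"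
  unfolding thompson.normal_inv_iff
proof (intro conjI ballI)
  show "subgroup compactly_supported thompson_F"
  proof (rule thompson.subgroupI)
    show "compactly_supported \<subseteq> carrier thompson_F"
      by (auto simp: compactly_supported_def)
    have "id \<in> compactly_supported"
      using thompson.one_closed by (simp add: compactly_supported_def)
    then show "compactly_supported \<noteq> {}"
      by blast
    show "inv\<^bsub>thompson_F\<^esub> f \<in> compactly_supported" if "f \<in> compactly_supported" for f
      using that thompson_translation_inv[of f _ 0] thompson.inv_closed[of f]
      by (auto simp: compactly_supported_def)
    show "f \<otimes>\<^bsub>thompson_F\<^esub> g \<in> compactly_supported"
      if "f \<in> compactly_supported" "g \<in> compactly_supported" for f g
      using that thompson_translation_comp[of g _ f 0 0] thompson.m_closed[of f g]
      by (auto simp: compactly_supported_def)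
  qed
next
  fix g f assume g: "g \<in> carrier thompson_F" and f: "f \<in> compactly_supported"
  have mem: "g \<in> thompson_homeos" "f \<in> thompson_homeos" "inv\<^bsub>thompson_F\<^esub> g \<in> thompson_homeos"
    using f g thompson.inv_closed[OF g] by (auto simp: compactly_supported_def)
  have "\<forall>\<^sub>F t in \<Phi>. (g \<circ> f \<circ> inv\<^bsub>thompson_F\<^esub> g) t = t" if \<Phi>: "\<Phi> = at_top \<or> \<Phi> = at_bot" for \<Phi>
  proof -
    obtain r :: real where r: "\<forall>\<^sub>F t in \<Phi>. g t = t + r"
      using mem(1) \<Phi> by (auto simp: thompson_homeos_iff germ_homeo_def)
    have "\<forall>\<^sub>F t in \<Phi>. f t = t + 0"
      using f \<Phi> by (auto simp: compactly_supported_def)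
    from thompson_translation_comp[OF mem(3) \<Phi> thompson_translation_comp[OF mem(2) \<Phi> r this]
        thompson_translation_inv[OF mem(1) \<Phi> r]]
    show ?thesis
      by simp
  qed
  then show "g \<otimes>\<^bsub>thompson_F\<^esub> f \<otimes>\<^bsub>thompson_F\<^esub> inv\<^bsub>thompson_F\<^esub> g \<in> compactly_supported"
    using thompson.m_closed[OF thompson.m_closed[OF g, of f] thompson.inv_closed[OF g]] mem
    by (auto simp: compactly_supported_def)
qed

section \<open>Translations of the line and of its ends\<close>

definition shift :: "int \<Rightarrow> real \<Rightarrow> real" where
  "shift n t = t + of_int n"

lemma shift_mem [simp]: "shift n \<in> thompson_homeos"
  using germ_homeo_shift[of n] by (simp add: thompson_homeos_iff shift_def[abs_def])

lemma shift_pow: "shift m [^]\<^bsub>thompson_F\<^esub> (n::nat) = shift (int n * m)"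
  by (induction n) (auto simp: shift_def algebra_simps)

lemma inv_shift: "inv\<^bsub>thompson_F\<^esub> (shift n) = shift (- n)"
  by (rule thompson.inv_equality) (auto simp: shift_def)

text \<open>Conjugating \<open>half_shift\<close> by a translation moves its bend from [0,1] to
  [n,n+1].\<close>

lemma right_translation_exists:
  obtains a where "a \<in> thompson_homeos" "\<And>t. t \<le> of_int n \<Longrightarrow> a t = t"
    "\<And>t. t \<ge> of_int n + 1 \<Longrightarrow> a t = t + 1"
proof
  have "half_shift \<in> thompson_homeos"
    using germ_homeo_half_shift by (simp add: thompson_homeos_iff)
  then show "shift n \<circ> half_shift \<circ> shift (- n) \<in> thompson_homeos"
    using thompson.m_closed[OF thompson.m_closed] shift_mem by simp
qed (auto simp: shift_def half_shift_def)

lemma left_translation_exists: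
  obtains b where "b \<in> thompson_homeos" "\<And>t. t \<ge> of_int n \<Longrightarrow> b t = t"
    "\<forall>\<^sub>F t in at_bot. b t = t + 1"
proof -
  \<comment> \<open>With \<open>n - 1\<close> in place of \<open>n\<close>, \<open>a\<close> is
    already translation by 1 on all t \<ge> n, so its inverse undoes \<open>shift 1\<close>
    there.\<close>
  obtain a where a: "a \<in> thompson_homeos" "\<And>t. t \<le> of_int (n - 1) \<Longrightarrow> a t = t"
    "\<And>t. t \<ge> of_int (n - 1) + 1 \<Longrightarrow> a t = t + 1"
    using right_translation_exists[of "n - 1"] by blast
  \<comment> \<open>dividing the translation of the whole line by one of the right half leaves the left half\<close>
  let ?b = "inv\<^bsub>thompson_F\<^esub> a \<circ> shift 1"
  have inv: "(inv\<^bsub>thompson_F\<^esub> a) (a t) = t" for t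
    using thompson.l_inv[of a] a(1) by (auto dest: fun_cong[of _ _ t])
  show thesis
  proof
    show "?b \<in> thompson_homeos"
      using thompson.m_closed[OF thompson.inv_closed, of a "shift 1"] a(1) by simp
    show "?b t = t" if "t \<ge> of_int n" for t
      using a(3)[of t] inv[of t] that by (simp add: shift_def)
    \<comment> \<open>Here t + 1 is still below n - 1, where \<open>a\<close> and its inverse are
      the identity.\<close>
    have "?b t = t + 1" if "t < of_int n - 2" for t
      using a(2)[of "t + 1"] inv[of "t + 1"] that by (simp add: shift_def)
    then show "\<forall>\<^sub>F t in at_bot. ?b t = t + 1"
      unfolding eventually_at_bot_dense by blast
  qed
qed

text \<open>\<open>A\<close> consists of the products of powers of two one-sided translations, one
  living to the right of \<open>n\<close> and one to the left of \<open>- n\<close>. They commute by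
  disjointness of supports and realise every pair of translation lengths at the two ends, so each
  \<open>f\<close> can be corrected to length 0. A large \<open>n\<close> keeps the correction off
  any given bounded set.\<close>

lemma abelian_complement:
  assumes "n \<ge> 0"
  obtains A where "A \<subseteq> thompson_homeos" "\<And>a b. a \<in> A \<Longrightarrow> b \<in> A \<Longrightarrow> a \<circ> b = b \<circ> a"
    "\<And>f. f \<in> thompson_homeos \<Longrightarrow> \<exists>a\<in>A. f \<circ> a \<in> compactly_supported"
    "\<And>a. a \<in> A \<Longrightarrow> inv\<^bsub>thompson_F\<^esub> a \<in> A"
    "\<And>a t. a \<in> A \<Longrightarrow> \<bar>t\<bar> \<le> of_int n \<Longrightarrow> a t = t"
proof -
  obtain a where a: "a \<in> thompson_homeos" "\<And>t. t \<le> of_int n \<Longrightarrow> a t = t"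
    "\<And>t. t \<ge> of_int n + 1 \<Longrightarrow> a t = t + 1"
    using right_translation_exists[of n] by blast
  obtain b where b: "b \<in> thompson_homeos" "\<And>t. t \<ge> of_int (- n) \<Longrightarrow> b t = t"
    "\<forall>\<^sub>F t in at_bot. b t = t + 1"
    using left_translation_exists[of "- n"] by blast
  define pa pb where "pa = (\<lambda>i::int. a [^]\<^bsub>thompson_F\<^esub> i)" and "pb = (\<lambda>i::int. b [^]\<^bsub>thompson_F\<^esub> i)"
  have mem: "pa i \<in> thompson_homeos" "pb i \<in> thompson_homeos" for i
    using thompson.int_pow_closed[of a i] thompson.int_pow_closed[of b i] a(1) b(1)
    by (auto simp: pa_def pb_def)
  have fixa: "pa i t = t" if "t \<le> of_int n" for i t
    unfolding pa_def using thompson_int_pow_fixes a that by blast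
  have fixb: "pb i t = t" if "t \<ge> of_int (- n)" for i t
    unfolding pb_def using thompson_int_pow_fixes b that by blast
  \<comment> \<open>Since n \<ge> 0, every \<open>t\<close> satisfies t \<le> n or t \<ge> -n, so at
    least one of the two powers fixes it.\<close>
  have "pa i t = t \<or> pb j t = t" for i j t
    using fixa[of t i] fixb[of t j] assms by linarith
  then have ab: "pa i \<circ> pb j = pb j \<circ> pa i" for i j
    using thompson_disjoint_support_commute mem by blast
  have aa: "pa i \<circ> pa j = pa (i + j)" and bb: "pb i \<circ> pb j = pb (i + j)" for i j
    using thompson.int_pow_mult[of a i j] thompson.int_pow_mult[of b i j] a(1) b(1)
    by (auto simp: pa_def pb_def)
  have aa': "pa i \<circ> pa j = pa j \<circ> pa i" and bb': "pb i \<circ> pb j = pb j \<circ> pb i" for i j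
    by (simp_all add: aa bb add.commute)
  define A where "A = {pa i \<circ> pb j | i j. True}"
  show thesis
  proof
    show "A \<subseteq> thompson_homeos"
      using mem thompson.m_closed by (force simp: A_def)
    show "x \<circ> y = y \<circ> x" if "x \<in> A" "y \<in> A" for x y
    proof -
      obtain i j k l where "x = pa i \<circ> pb j" "y = pa k \<circ> pb l"
        using \<open>x \<in> A\<close> \<open>y \<in> A\<close> unfolding A_def by blast
      then show ?thesis
        using thompson.products_commute[of "pa i" "pb j" "pa k" "pb l"] mem ab aa' bb' by simp
    qed
    show "inv\<^bsub>thompson_F\<^esub> x \<in> A" if "x \<in> A" for x
    proof -
      obtain i j where x: "x = pa i \<circ> pb j"
        using \<open>x \<in> A\<close> unfolding A_def by blast
      have "inv\<^bsub>thompson_F\<^esub> (pa i) = pa (- i)" "inv\<^bsub>thompson_F\<^esub> (pb j) = pb (- j)"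
        using thompson.int_pow_neg a(1) b(1) by (simp_all add: pa_def pb_def)
      then have "inv\<^bsub>thompson_F\<^esub> x = pb (- j) \<circ> pa (- i)"
        using thompson.inv_mult_group[of "pa i" "pb j"] mem by (simp add: x)
      then show ?thesis
        using ab unfolding A_def by (metis (mono_tags, lifting) mem_Collect_eq)
    qed
    show "x t = t" if "x \<in> A" "\<bar>t\<bar> \<le> of_int n" for x t
      using that fixa fixb by (auto simp: A_def)
    show "\<exists>x\<in>A. f \<circ> x \<in> compactly_supported" if f: "f \<in> thompson_homeos" for f
    proof -
      obtain r l :: int where r: "\<forall>\<^sub>F t in at_top. f t = t + of_int r"
        and l: "\<forall>\<^sub>F t in at_bot. f t = t + of_int l"
        using f by (auto simp: thompson_homeos_iff germ_homeo_def)
      have "\<forall>\<^sub>F t in at_top. a t = t + 1"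
        unfolding eventually_at_top_linorder using a(3) by blast
      \<comment> \<open>The exponents \<open>- r\<close> and \<open>- l\<close> cancel the
        translation lengths of \<open>f\<close>; each of the two powers is the identity near the
        other end and leaves that length alone.\<close>
      from thompson_translation_int_pow[OF a(1) _ this, of "- r"]
      have a_top: "\<forall>\<^sub>F t in at_top. pa (- r) t = t + - of_int r"
        by (simp add: pa_def)
      have a_bot: "\<forall>\<^sub>F t in at_bot. pa (- r) t = t + 0"
        unfolding eventually_at_bot_linorder using fixa by auto
      have b_top: "\<forall>\<^sub>F t in at_top. pb (- l) t = t + 0"
        unfolding eventually_at_top_linorder using fixb by auto
      from thompson_translation_int_pow[OF b(1) _ b(3), of "- l"]
      have b_bot: "\<forall>\<^sub>F t in at_bot. pb (- l) t = t + - of_int l"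
        by (simp add: pb_def)
      have ab_mem: "pa (- r) \<circ> pb (- l) \<in> thompson_homeos"
        using mem thompson.m_closed by force
      have "\<forall>\<^sub>F t in at_top. (f \<circ> (pa (- r) \<circ> pb (- l))) t = t"
        using thompson_translation_comp[OF ab_mem _ r thompson_translation_comp[OF mem(2) _ a_top b_top]]
        by simp
      moreover have "\<forall>\<^sub>F t in at_bot. (f \<circ> (pa (- r) \<circ> pb (- l))) t = t"
        using thompson_translation_comp[OF ab_mem _ l thompson_translation_comp[OF mem(2) _ a_bot b_bot]]
        by simp
      moreover have "f \<circ> (pa (- r) \<circ> pb (- l)) \<in> thompson_homeos"
        using thompson.m_closed[of f] f ab_mem by simp
      ultimately show ?thesis
        unfolding A_def compactly_supported_def by blast
    qed
  qed
qed

section \<open>Comparing derived subgroups\<close>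

lemma commutator_compactly_supported_mem:
  assumes c: "c \<in> compactly_supported" and g: "g \<in> thompson_homeos"
  shows "c \<otimes>\<^bsub>thompson_F\<^esub> g \<otimes>\<^bsub>thompson_F\<^esub> inv\<^bsub>thompson_F\<^esub> c \<otimes>\<^bsub>thompson_F\<^esub> inv\<^bsub>thompson_F\<^esub> g
    \<in> derived thompson_F compactly_supported"
proof -
  have c': "c \<in> thompson_homeos"
    using c by (simp add: compactly_supported_def)
  obtain M where M: "M > 0" "\<And>t. \<bar>t\<bar> > M \<Longrightarrow> c t = t"
    using compactly_supported_bound[OF c] by blast
  \<comment> \<open>Rounding \<open>M\<close> up gives the integer bound for which \<open>A\<close>
    fixes all of [-M,M], while \<open>c\<close> is the identity outside that interval.\<close>
  obtain A where A: "A \<subseteq> thompson_homeos"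
    "\<And>f. f \<in> thompson_homeos \<Longrightarrow> \<exists>a\<in>A. f \<circ> a \<in> compactly_supported"
    "\<And>a t. a \<in> A \<Longrightarrow> \<bar>t\<bar> \<le> of_int \<lceil>M\<rceil> \<Longrightarrow> a t = t"
    using abelian_complement[of "\<lceil>M\<rceil>"] M(1) by (metis ceiling_le_zero leI le_cases linorder_not_le)
  obtain a where a: "a \<in> A" "g \<circ> a \<in> compactly_supported"
    using A(2)[OF g] by blast
  have "a t = t \<or> c t = t" for t
    using A(3)[OF a(1), of t] M(2)[of t] by linarith
  then have "a \<circ> c = c \<circ> a"
    using thompson_disjoint_support_commute a(1) A(1) c' by blast
  \<comment> \<open>\<open>g \<circ> a\<close> is compactly supported and has the same commutator with \<open>c\<close> as \<open>g\<close>\<close>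
  then have "c \<otimes>\<^bsub>thompson_F\<^esub> (g \<otimes>\<^bsub>thompson_F\<^esub> a) \<otimes>\<^bsub>thompson_F\<^esub> inv\<^bsub>thompson_F\<^esub> c
      \<otimes>\<^bsub>thompson_F\<^esub> inv\<^bsub>thompson_F\<^esub> (g \<otimes>\<^bsub>thompson_F\<^esub> a)
    = c \<otimes>\<^bsub>thompson_F\<^esub> g \<otimes>\<^bsub>thompson_F\<^esub> inv\<^bsub>thompson_F\<^esub> c \<otimes>\<^bsub>thompson_F\<^esub> inv\<^bsub>thompson_F\<^esub> g"
    using thompson.commutator_absorb[of c "\<one>\<^bsub>thompson_F\<^esub>" g a] thompson.one_closed g c' a(1) A(1)
    by auto
  moreover have "c \<otimes>\<^bsub>thompson_F\<^esub> (g \<otimes>\<^bsub>thompson_F\<^esub> a) \<otimes>\<^bsub>thompson_F\<^esub> inv\<^bsub>thompson_F\<^esub> c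
      \<otimes>\<^bsub>thompson_F\<^esub> inv\<^bsub>thompson_F\<^esub> (g \<otimes>\<^bsub>thompson_F\<^esub> a) \<in> derived thompson_F compactly_supported"
    unfolding derived_def using c a(2) by (intro generate.incl) auto
  ultimately show ?thesis
    by simp
qed

text \<open>The abstract criterion is applied with \<open>D\<close> the derived subgroup of
  \<open>compactly_supported\<close>, which is normal in F because
  \<open>compactly_supported\<close> is. The complement with \<open>n = 0\<close> provides the
  decomposition.\<close>

lemma derived_thompson_subset:
  "derived thompson_F thompson_homeos \<subseteq> derived thompson_F compactly_supported"
proof -
  obtain A where A: "A \<subseteq> thompson_homeos" "\<And>a b. a \<in> A \<Longrightarrow> b \<in> A \<Longrightarrow> a \<circ> b = b \<circ> a"
    "\<And>f. f \<in> thompson_homeos \<Longrightarrow> \<exists>a\<in>A. f \<circ> a \<in> compactly_supported"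
    "\<And>a. a \<in> A \<Longrightarrow> inv\<^bsub>thompson_F\<^esub> a \<in> A"
    using abelian_complement[of 0] by (metis order_refl)
  have "\<exists>c\<in>compactly_supported. \<exists>a\<in>A. g = c \<circ> a" if g: "g \<in> thompson_homeos" for g
  proof -
    obtain a where a: "a \<in> A" "g \<circ> a \<in> compactly_supported"
      using A(3)[OF g] by blast
    have "g = (g \<circ> a) \<circ> inv\<^bsub>thompson_F\<^esub> a"
      using thompson.r_inv[of a] a(1) A(1) by (auto simp: comp_assoc)
    then show ?thesis
      using a A(4) by blast
  qed
  then have "derived thompson_F (carrier thompson_F) \<subseteq> derived thompson_F compactly_supported"
    using A commutator_compactly_supported_mem
    by (intro thompson.derived_subset_if_central_times_abelian[where C = compactly_supported and A = A]
        thompson.derived_is_normal compactly_supported_normal)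
      (auto simp: compactly_supported_def)
  then show ?thesis
    by simp
qed

lemma derived_compactly_supported_subset:
  assumes H: "subgroup H thompson_F" and fin: "finite (rcosets\<^bsub>thompson_F\<^esub> H)"
  shows "derived thompson_F compactly_supported \<subseteq> derived thompson_F H"
proof -
  have sub: "subgroup (derived thompson_F H) thompson_F"
    using thompson.derived_is_subgroup subgroup.subset[OF H] by blast
  have "h \<otimes>\<^bsub>thompson_F\<^esub> f \<otimes>\<^bsub>thompson_F\<^esub> inv\<^bsub>thompson_F\<^esub> h \<otimes>\<^bsub>thompson_F\<^esub> inv\<^bsub>thompson_F\<^esub> f
      \<in> derived thompson_F H"
    if h: "h \<in> compactly_supported" and f: "f \<in> compactly_supported" for h f
  proof -
    have mem: "h \<in> thompson_homeos" "f \<in> thompson_homeos"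
      using h f by (auto simp: compactly_supported_def)
    then have inv_mem: "inv\<^bsub>thompson_F\<^esub> h \<in> thompson_homeos" "inv\<^bsub>thompson_F\<^esub> f \<in> thompson_homeos"
      using thompson.inv_closed by auto
    obtain A where A: "A > 0" "\<And>t. \<bar>t\<bar> > A \<Longrightarrow> h t = t"
      using compactly_supported_bound[OF h] by blast
    obtain B where B: "B > 0" "\<And>t. \<bar>t\<bar> > B \<Longrightarrow> f t = t"
      using compactly_supported_bound[OF f] by blast
    define M where "M = max A B"
    have M: "M > 0" "\<And>t. \<bar>t\<bar> > M \<Longrightarrow> h t = t" "\<And>t. \<bar>t\<bar> > M \<Longrightarrow> f t = t"
      using A B by (auto simp: M_def)
    have Mi: "(inv\<^bsub>thompson_F\<^esub> h) t = t" "(inv\<^bsub>thompson_F\<^esub> f) t = t" if "\<bar>t\<bar> > M" for t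
      using thompson_inv_fixes mem M(2,3)[OF that] by auto
    \<comment> \<open>A power of the conjugate of \<open>shift 1\<close> by \<open>g\<close> is the
      conjugate of a longer translation. Keeping all multiples of \<open>n\<close> allows one
      translation length to serve several \<open>g\<close> at once.\<close>
    have pow: "\<exists>n::nat>0. \<forall>k::nat.
        g \<otimes>\<^bsub>thompson_F\<^esub> shift (int (n * k)) \<otimes>\<^bsub>thompson_F\<^esub> inv\<^bsub>thompson_F\<^esub> g \<in> H"
      if g: "g \<in> thompson_homeos" for g
    proof -
      have gs: "g \<otimes>\<^bsub>thompson_F\<^esub> shift 1 \<otimes>\<^bsub>thompson_F\<^esub> inv\<^bsub>thompson_F\<^esub> g \<in> carrier thompson_F"
        using g by (intro thompson.m_closed thompson.inv_closed) auto
      then obtain n :: nat where n: "n > 0"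
        "(g \<otimes>\<^bsub>thompson_F\<^esub> shift 1 \<otimes>\<^bsub>thompson_F\<^esub> inv\<^bsub>thompson_F\<^esub> g) [^]\<^bsub>thompson_F\<^esub> n \<in> H"
        using thompson.finite_index_pow_mem[OF H fin] by blast
      have "(g \<otimes>\<^bsub>thompson_F\<^esub> shift 1 \<otimes>\<^bsub>thompson_F\<^esub> inv\<^bsub>thompson_F\<^esub> g) [^]\<^bsub>thompson_F\<^esub> (n * k) \<in> H" for k
        using thompson.nat_pow_pow[OF gs, of n k] thompson.subgroup_int_pow_closed[OF H n(2), of "int k"]
        by (simp add: int_pow_int del: thompson_F_simps)
      then have "g \<otimes>\<^bsub>thompson_F\<^esub> shift (int (n * k)) \<otimes>\<^bsub>thompson_F\<^esub> inv\<^bsub>thompson_F\<^esub> g \<in> H" for k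
        using thompson.conj_nat_pow[of g "shift 1"] g by (simp add: shift_pow del: thompson_F_simps(2))
      with n(1) show ?thesis
        by blast
    qed
    obtain n1 n2 n3 :: nat where n: "n1 > 0" "n2 > 0" "n3 > 0" and n1:
      "\<And>k::nat. id \<otimes>\<^bsub>thompson_F\<^esub> shift (int (n1 * k)) \<otimes>\<^bsub>thompson_F\<^esub> inv\<^bsub>thompson_F\<^esub> id \<in> H" and n2:
      "\<And>k::nat. h \<otimes>\<^bsub>thompson_F\<^esub> shift (int (n2 * k)) \<otimes>\<^bsub>thompson_F\<^esub> inv\<^bsub>thompson_F\<^esub> h \<in> H" and n3:
      "\<And>k::nat. f \<otimes>\<^bsub>thompson_F\<^esub> shift (int (n3 * k)) \<otimes>\<^bsub>thompson_F\<^esub> inv\<^bsub>thompson_F\<^esub> f \<in> H"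
      using pow[of id] pow[OF mem(1)] pow[OF mem(2)] thompson.one_closed by auto
    obtain L :: nat where L: "real L > 2 * M"
      using reals_Archimedean2 by blast
    \<comment> \<open>Divisible by \<open>n1\<close>, \<open>n2\<close> and \<open>n3\<close>, so
      that \<open>H\<close> contains the translation by \<open>N\<close> and its conjugates by
      \<open>h\<close> and \<open>f\<close>; the factor \<open>L\<close> makes it exceed
      \<open>2 * M\<close>, which separates the supports.\<close>
    define N where "N = n1 * n2 * n3 * L"
    have "L \<le> N"
      using n by (simp add: N_def)
    then have N: "real N > 2 * M"
      using L by (meson less_le_trans of_nat_le_iff)
    have s: "shift (int N) \<in> H"
      using n1[of "n2 * n3 * L"] thompson.inv_one by (simp add: N_def mult.assoc)
    then have s': "shift (- int N) \<in> H"
      using subgroup.m_inv_closed[OF H s] by (simp add: inv_shift)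
    have hs: "h \<circ> shift (int N) \<circ> inv\<^bsub>thompson_F\<^esub> h \<in> H"
      using n2[of "n1 * n3 * L"] by (simp add: N_def mult_ac)
    have fs: "f \<circ> shift (int N) \<circ> inv\<^bsub>thompson_F\<^esub> f \<in> H"
      using n3[of "n1 * n2 * L"] by (simp add: N_def mult_ac)
    have fs': "f \<circ> shift (- int N) \<circ> inv\<^bsub>thompson_F\<^esub> f \<in> H"
      using subgroup.m_inv_closed[OF H fs] mem inv_mem thompson.inv_mult_group[of f "shift (int N)"]
        thompson.inv_mult_group[of "f \<circ> shift (int N)" "inv\<^bsub>thompson_F\<^esub> f"]
        thompson.m_closed[of f "shift (int N)"]
      by (simp add: inv_shift comp_assoc)
    \<comment> \<open>Chosen so that \<open>h \<circ> k\<close> is the commutator of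
      \<open>h\<close> with the translation by \<open>N\<close>, and \<open>f \<circ> e\<close> that
      of \<open>f\<close> with the translation by \<open>- N\<close>. The opposite signs place
      \<open>k\<close> around \<open>N\<close> and \<open>e\<close> around \<open>- N\<close>, away
      from each other.\<close>
    define k e where "k = shift (int N) \<circ> inv\<^bsub>thompson_F\<^esub> h \<circ> shift (- int N)"
      and "e = shift (- int N) \<circ> inv\<^bsub>thompson_F\<^esub> f \<circ> shift (int N)"
    have ke_mem: "k \<in> thompson_homeos" "e \<in> thompson_homeos"
      using thompson.m_closed[OF thompson.m_closed] inv_mem by (simp_all add: k_def e_def)
    have k_fix: "k t = t" if "\<bar>t - real N\<bar> > M" for t
      using Mi(1)[OF that] by (simp add: k_def shift_def)
    have e_fix: "e t = t" if "\<bar>t + real N\<bar> > M" for t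
      using Mi(2)[OF that] by (simp add: e_def shift_def)
    have "h \<circ> k \<in> H"
      using subgroup.m_closed[OF H hs s'] by (simp add: k_def comp_assoc)
    moreover have "f \<circ> e \<in> H"
      using subgroup.m_closed[OF H fs' s] by (simp add: e_def comp_assoc)
    ultimately have "(h \<circ> k) \<otimes>\<^bsub>thompson_F\<^esub> (f \<circ> e) \<otimes>\<^bsub>thompson_F\<^esub> inv\<^bsub>thompson_F\<^esub> (h \<circ> k)
        \<otimes>\<^bsub>thompson_F\<^esub> inv\<^bsub>thompson_F\<^esub> (f \<circ> e) \<in> derived thompson_F H"
      unfolding derived_def by (intro generate.incl) auto
    \<comment> \<open>The intervals of radius \<open>M\<close> about \<open>- N\<close>, 0 and
      \<open>N\<close> are pairwise disjoint because \<open>N\<close> exceeds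
      \<open>2 * M\<close>.\<close>
    moreover have "k t = t \<or> f t = t" "e t = t \<or> h t = t" "k t = t \<or> e t = t" for t
      using k_fix[of t] e_fix[of t] M(1) M(2,3)[of t] N by linarith+
    then have "k \<circ> f = f \<circ> k" "e \<circ> h = h \<circ> e" "k \<circ> e = e \<circ> k"
      using thompson_disjoint_support_commute ke_mem mem by blast+
    then have "(h \<circ> k) \<otimes>\<^bsub>thompson_F\<^esub> (f \<circ> e) \<otimes>\<^bsub>thompson_F\<^esub> inv\<^bsub>thompson_F\<^esub> (h \<circ> k)
        \<otimes>\<^bsub>thompson_F\<^esub> inv\<^bsub>thompson_F\<^esub> (f \<circ> e)
      = h \<otimes>\<^bsub>thompson_F\<^esub> f \<otimes>\<^bsub>thompson_F\<^esub> inv\<^bsub>thompson_F\<^esub> h \<otimes>\<^bsub>thompson_F\<^esub> inv\<^bsub>thompson_F\<^esub> f"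
      using thompson.commutator_absorb[of h k f e] mem ke_mem by simp
    ultimately show ?thesis
      by simp
  qed
  then have "derived_set thompson_F compactly_supported \<subseteq> derived thompson_F H"
    by blast
  then show ?thesis
    unfolding derived_def[of _ compactly_supported] using thompson.generate_subgroup_incl[OF _ sub] by blast
qed

theorem proposition2p1:
  fixes H :: "(real \<Rightarrow> real) set"
  assumes "subgroup H thompson_F"
    and "finite (rcosets\<^bsub>thompson_F\<^esub> H)"
  shows "derived thompson_F (carrier thompson_F) \<subseteq> H \<and>
    H \<lhd> thompson_F \<and>
    derived thompson_F H = derived thompson_F (carrier thompson_F)"
proof -
  have le: "derived thompson_F (carrier thompson_F) \<subseteq> derived thompson_F H"
    using derived_thompson_subset derived_compactly_supported_subset[OF assms] by simp
  have ge: "derived thompson_F H \<subseteq> derived thompson_F (carrier thompson_F)"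
    using thompson.mono_derived subgroup.subset[OF assms(1)] by blast
  have sub: "derived thompson_F (carrier thompson_F) \<subseteq> H"
    using le thompson.derived_incl[OF order_refl assms(1)] by blast
  \<comment> \<open>A subgroup containing F' is normal: ghg^-1 is the commutator of \<open>g\<close>
    and \<open>h\<close> times \<open>h\<close>, and both factors lie in \<open>H\<close>.\<close>
  have "H \<lhd> thompson_F"
  proof (rule thompson.normal_invI[OF assms(1)])
    fix g h assume g: "g \<in> carrier thompson_F" and h: "h \<in> H"
    have h': "h \<in> carrier thompson_F"
      using h subgroup.subset[OF assms(1)] by blast
    have "g \<otimes>\<^bsub>thompson_F\<^esub> h \<otimes>\<^bsub>thompson_F\<^esub> inv\<^bsub>thompson_F\<^esub> g \<otimes>\<^bsub>thompson_F\<^esub> inv\<^bsub>thompson_F\<^esub> h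
        \<in> derived thompson_F (carrier thompson_F)"
      unfolding derived_def using g h' by (intro generate.incl) blast
    then have "(g \<otimes>\<^bsub>thompson_F\<^esub> h \<otimes>\<^bsub>thompson_F\<^esub> inv\<^bsub>thompson_F\<^esub> g \<otimes>\<^bsub>thompson_F\<^esub> inv\<^bsub>thompson_F\<^esub> h)
        \<otimes>\<^bsub>thompson_F\<^esub> h \<in> H"
      using sub h subgroup.m_closed[OF assms(1)] by blast
    then show "g \<otimes>\<^bsub>thompson_F\<^esub> h \<otimes>\<^bsub>thompson_F\<^esub> inv\<^bsub>thompson_F\<^esub> g \<in> H"
      using g h' by (simp add: thompson.m_assoc del: thompson_F_simps)
  qed
  with le ge sub show ?thesis
    by blast
qed

end
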